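(* Let $X$ be a propositional variable and $E$ a closed $\lambda\mu$-term with $\vdash E:\perp\to X$. Then for each finite sequence $x\,\bar y$ of distinct $\lambda$-variables, $(E\;x\,\bar y)\triangleright^*\underline{\mu}.x$, where $\underline{\mu}.x$ denotes a term consisting of the variable $x$ preceded by $\mu$-abstractions and $\mu$-applications (i.e. a term in the smallest set containing $x$ and closed under $s\mapsto\mu\alpha.s$ and $s\mapsto(\alpha\,s)$ for $\mu$-variables $\alpha$).
   Context: $\lambda\mu$-terms over disjoint infinite sets of $\lambda$-variables and $\mu$-variables: $t ::= x \mid \lambda x.t \mid (t\,t) \mid \mu\alpha.t \mid (\alpha\,t)$. $u[\alpha:=^*v]$ replaces inductively each subterm $(\alpha\,w)$ of $u$ by $(\alpha\,(w\,v))$. Reduction $\triangleright$: compatible closure of $(\lambda x.u\;v)\triangleright u[x:=v]$ and $(\mu\alpha.u\;v)\triangleright\mu\alpha.u[\alpha:=^*v]$; $\triangleright^*$ its reflexive transitive closure. For $\bar y=y_1\dots y_n$, $(t\,x\,\bar y)=(\dots((t\,x)\,y_1)\dots y_n)$. Types: $A ::= X\mid\perp\mid A\to A$. Typing rules for $\Gamma\vdash t:A;\Delta$: (ax) $\Gamma\vdash x:A;\Delta$ if $x:A\in\Gamma$; ($\to_i$) from $\Gamma,x:A\vdash t:B;\Delta$ infer $\Gamma\vdash\lambda x.t:A\to B;\Delta$; ($\to_e$) from $\Gamma\vdash u:A\to B;\Delta$ and $\Gamma\vdash v:A;\Delta$ infer $\Gamma\vdash(u\,v):B;\Delta$; ($\mu$)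 from $\Gamma\vdash t:\perp;\Delta,\alpha:A$ infer $\Gamma\vdash\mu\alpha.t:A;\Delta$; ($\perp$) from $\Gamma\vdash t:A;\Delta,\alpha:A$ infer $\Gamma\vdash(\alpha\,t):\perp;\Delta,\alpha:A$. $\vdash E:A$ means empty contexts. *)

theory Defs
  imports Main
begin

text \<open>
  Terms up to renaming of bound variables are represented by de Bruijn indices, with two
  independent index spaces: \<open>Lam\<close> binds index 0 among the \<open>\<lambda>\<close>-variables and \<open>Mu\<close> binds
  index 0 among the \<open>\<mu>\<close>-variables. A free variable is an index pointing beyond all the
  enclosing binders of its kind. \<open>MApp a t\<close> is the \<open>\<mu>\<close>-application of the \<open>\<mu>\<close>-variable \<open>a\<close>
  to \<open>t\<close>.
\<close>

datatype trm =
    LVar nat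
  | Lam trm
  | App trm trm
  | Mu trm
  | MApp nat trm

primrec lfv :: "trm \<Rightarrow> nat set" where
  "lfv (LVar i) = {i}"
| "lfv (Lam t) = {i. Suc i \<in> lfv t}"
| "lfv (App t u) = lfv t \<union> lfv u"
| "lfv (Mu t) = lfv t"
| "lfv (MApp a t) = lfv t"

primrec mfv :: "trm \<Rightarrow> nat set" where
  "mfv (LVar i) = {}"
| "mfv (Lam t) = mfv t"
| "mfv (App t u) = mfv t \<union> mfv u"
| "mfv (Mu t) = {a. Suc a \<in> mfv t}"
| "mfv (MApp a t) = insert a (mfv t)"

definition closed_trm :: "trm \<Rightarrow> bool" where
  "closed_trm t \<longleftrightarrow> lfv t = {} \<and> mfv t = {}"

text \<open>\<open>llift t k\<close> and \<open>mlift t k\<close> increment the \<open>\<lambda>\<close>- resp. \<open>\<mu>\<close>-indices from \<open>k\<close> upwards.\<close>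

primrec llift :: "trm \<Rightarrow> nat \<Rightarrow> trm" where
  "llift (LVar i) k = LVar (if i < k then i else Suc i)"
| "llift (Lam t) k = Lam (llift t (Suc k))"
| "llift (App t u) k = App (llift t k) (llift u k)"
| "llift (Mu t) k = Mu (llift t k)"
| "llift (MApp a t) k = MApp a (llift t k)"

primrec mlift :: "trm \<Rightarrow> nat \<Rightarrow> trm" where
  "mlift (LVar i) k = LVar i"
| "mlift (Lam t) k = Lam (mlift t k)"
| "mlift (App t u) k = App (mlift t k) (mlift u k)"
| "mlift (Mu t) k = Mu (mlift t (Suc k))"
| "mlift (MApp a t) k = MApp (if a < k then a else Suc a) (mlift t k)"

text \<open>
  \<open>lsubst u k v\<close> is \<open>u[x := v]\<close> for the \<open>\<lambda>\<close>-variable \<open>x\<close> with index \<open>k\<close>. The variable is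
  consumed, so \<open>\<lambda>\<close>-indices above \<open>k\<close> are decremented.
\<close>

primrec lsubst :: "trm \<Rightarrow> nat \<Rightarrow> trm \<Rightarrow> trm" where
  "lsubst (LVar i) k v = (if i < k then LVar i else if i = k then v else LVar (i - 1))"
| "lsubst (Lam t) k v = Lam (lsubst t (Suc k) (llift v 0))"
| "lsubst (App t u) k v = App (lsubst t k v) (lsubst u k v)"
| "lsubst (Mu t) k v = Mu (lsubst t k (mlift v 0))"
| "lsubst (MApp a t) k v = MApp a (lsubst t k v)"

text \<open>
  \<open>msubst u a v\<close> is \<open>u[\<alpha> :=* v]\<close> for the \<open>\<mu>\<close>-variable \<open>\<alpha>\<close> with index \<open>a\<close>. The variable
  survives, so no \<open>\<mu>\<close>-index is decremented.
\<close>

primrec msubst :: "trm \<Rightarrow> nat \<Rightarrow> trm \<Rightarrow> trm" where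
  "msubst (LVar i) a v = LVar i"
| "msubst (Lam t) a v = Lam (msubst t a (llift v 0))"
| "msubst (App t u) a v = App (msubst t a v) (msubst u a v)"
| "msubst (Mu t) a v = Mu (msubst t (Suc a) (mlift v 0))"
| "msubst (MApp b t) a v =
     (if b = a then MApp b (App (msubst t a v) v) else MApp b (msubst t a v))"

text \<open>
  In \<open>red_mu\<close> the argument moves under the \<open>\<mu>\<close>-binder, so its \<open>\<mu>\<close>-indices are lifted.
\<close>

inductive red :: "trm \<Rightarrow> trm \<Rightarrow> bool" where
  red_beta: "red (App (Lam u) v) (lsubst u 0 v)"
| red_mu: "red (App (Mu u) v) (Mu (msubst u 0 (mlift v 0)))"
| red_Lam: "red t t' \<Longrightarrow> red (Lam t) (Lam t')"
| red_AppL: "red t t' \<Longrightarrow> red (App t u) (App t' u)"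
| red_AppR: "red u u' \<Longrightarrow> red (App t u) (App t u')"
| red_Mu: "red t t' \<Longrightarrow> red (Mu t) (Mu t')"
| red_MApp: "red t t' \<Longrightarrow> red (MApp a t) (MApp a t')"

abbreviation reds :: "trm \<Rightarrow> trm \<Rightarrow> bool" where
  "reds \<equiv> red\<^sup>*\<^sup>*"

definition apps :: "trm \<Rightarrow> trm list \<Rightarrow> trm" where
  "apps t us = foldl App t us"

datatype ty =
    TVar nat
  | Bot
  | Arrow ty ty

text \<open>
  \<open>typing \<Gamma> t A \<Delta>\<close> is \<open>\<Gamma> \<turnstile> t : A ; \<Delta>\<close>. The \<open>i\<close>-th entry of \<open>\<Gamma>\<close> (\<open>\<Delta>\<close>) is the type of the
  \<open>\<lambda>\<close>-variable (\<open>\<mu>\<close>-variable) with index \<open>i\<close>.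
\<close>

inductive typing :: "ty list \<Rightarrow> trm \<Rightarrow> ty \<Rightarrow> ty list \<Rightarrow> bool" where
  typing_ax: "\<lbrakk>i < length \<Gamma>; \<Gamma> ! i = A\<rbrakk> \<Longrightarrow> typing \<Gamma> (LVar i) A \<Delta>"
| typing_arrI: "typing (A # \<Gamma>) t B \<Delta> \<Longrightarrow> typing \<Gamma> (Lam t) (Arrow A B) \<Delta>"
| typing_arrE: "\<lbrakk>typing \<Gamma> u (Arrow A B) \<Delta>; typing \<Gamma> v A \<Delta>\<rbrakk> \<Longrightarrow> typing \<Gamma> (App u v) B \<Delta>"
| typing_mu: "typing \<Gamma> t Bot (A # \<Delta>) \<Longrightarrow> typing \<Gamma> (Mu t) A \<Delta>"
| typing_bot: "\<lbrakk>typing \<Gamma> t A \<Delta>; a < length \<Delta>; \<Delta> ! a = A\<rbrakk> \<Longrightarrow> typing \<Gamma> (MApp a t) Bot \<Delta>"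

text \<open>
  The terms consisting of the \<open>\<lambda>\<close>-variable \<open>x\<close> preceded by \<open>\<mu>\<close>-abstractions and
  \<open>\<mu>\<close>-applications. No \<open>\<lambda>\<close>-binder is crossed, so the index \<open>x\<close> stays the same throughout.
\<close>

inductive_set mu_prefixed :: "nat \<Rightarrow> trm set" for x :: nat where
  mu_prefixed_var: "LVar x \<in> mu_prefixed x"
| mu_prefixed_Mu: "s \<in> mu_prefixed x \<Longrightarrow> Mu s \<in> mu_prefixed x"
| mu_prefixed_MApp: "s \<in> mu_prefixed x \<Longrightarrow> MApp a s \<in> mu_prefixed x"

end

theory Submission imports Defs
begin

text \<open>
  Realizability by orthogonality: every type \<open>A\<close> is interpreted by a set of stacks (argument
  lists), and a term realizes \<open>A\<close> if, applied to any such stack, it reduces to a term of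
  \<open>mu_prefixed x\<close>. The stacks are \<open>[]\<close> for \<open>\<bottom>\<close> and the given sequence of variables for each
  propositional variable; a stack of \<open>A \<rightarrow> B\<close> is a realizer of \<open>A\<close> followed by a stack of \<open>B\<close>.
  Typed terms are realizers, where a \<open>\<mu>\<close>-variable of type \<open>A\<close> is instantiated by a stack of
  \<open>A\<close>. Since \<open>x\<close> realizes \<open>\<bottom>\<close>, the theorem is the case of the term \<open>E\<close>.
\<close>

subsection \<open>Simultaneous renaming and substitution\<close>

text \<open>\<open>case_nat 0 (Suc \<circ> \<rho>)\<close> carries a renaming under a binder: it
  fixes the bound index 0 and shifts the rest. With arbitrary functions as renamings, lifting at any
  cutoff is an instance.\<close>

primrec ren :: "(nat \<Rightarrow> nat) \<Rightarrow> (nat \<Rightarrow> nat) \<Rightarrow> trm \<Rightarrow> trm" where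
  "ren \<rho> \<theta> (LVar i) = LVar (\<rho> i)"
| "ren \<rho> \<theta> (Lam t) = Lam (ren (case_nat 0 (Suc \<circ> \<rho>)) \<theta> t)"
| "ren \<rho> \<theta> (App t u) = App (ren \<rho> \<theta> t) (ren \<rho> \<theta> u)"
| "ren \<rho> \<theta> (Mu t) = Mu (ren \<rho> (case_nat 0 (Suc \<circ> \<theta>)) t)"
| "ren \<rho> \<theta> (MApp a t) = MApp (\<theta> a) (ren \<rho> \<theta> t)"

text \<open>
  \<open>\<theta>\<close> renames the \<open>\<mu>\<close>-variables and \<open>\<kappa> a\<close> is the list of arguments passed to the named
  subterms of \<open>a\<close>, so both \<open>lsubst\<close> and \<open>msubst\<close> are instances.
\<close>

primrec sub :: "(nat \<Rightarrow> trm) \<Rightarrow> (nat \<Rightarrow> nat) \<Rightarrow> (nat \<Rightarrow> trm list) \<Rightarrow> trm \<Rightarrow> trm" where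
  "sub \<sigma> \<theta> \<kappa> (LVar i) = \<sigma> i"
| "sub \<sigma> \<theta> \<kappa> (Lam t) =
     Lam (sub (case_nat (LVar 0) (ren Suc id \<circ> \<sigma>)) \<theta> (map (ren Suc id) \<circ> \<kappa>) t)"
| "sub \<sigma> \<theta> \<kappa> (App t u) = App (sub \<sigma> \<theta> \<kappa> t) (sub \<sigma> \<theta> \<kappa> u)"
| "sub \<sigma> \<theta> \<kappa> (Mu t) =
     Mu (sub (ren id Suc \<circ> \<sigma>) (case_nat 0 (Suc \<circ> \<theta>)) (case_nat [] (map (ren id Suc) \<circ> \<kappa>)) t)"
| "sub \<sigma> \<theta> \<kappa> (MApp a t) = MApp (\<theta> a) (apps (sub \<sigma> \<theta> \<kappa> t) (\<kappa> a))"

lemma apps_Nil [simp]: "apps t [] = t"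
  by (simp add: apps_def)

lemma apps_Cons [simp]: "apps t (u # us) = apps (App t u) us"
  by (simp add: apps_def)

lemma apps_append: "apps t (us @ vs) = apps (apps t us) vs"
  by (simp add: apps_def)

lemma ren_apps: "ren \<rho> \<theta> (apps t us) = apps (ren \<rho> \<theta> t) (map (ren \<rho> \<theta>) us)"
  by (induction us arbitrary: t) simp_all

lemma sub_apps: "sub \<sigma> \<theta> \<kappa> (apps t us) = apps (sub \<sigma> \<theta> \<kappa> t) (map (sub \<sigma> \<theta> \<kappa>) us)"
  by (induction us arbitrary: t) simp_all

lemma case_nat_Suc_id [simp]: "case_nat 0 (Suc \<circ> id) = id" "case_nat 0 Suc = id"
  by (auto simp: fun_eq_iff split: nat.split)

text \<open>
  The induction method eta-expands function arguments such as \<open>id\<close> and \<open>f \<circ> g\<close>, which these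
  two rules would then unfold under the abstraction.
\<close>

declare id_apply [simp del] comp_apply [simp del]

lemma ren_id [simp]: "ren id id t = t"
  by (induction t) (simp_all, simp_all add: id_apply)

section \<open>Composition laws for renaming and substitution\<close>

lemma ren_ren: "ren \<rho>' \<theta>' (ren \<rho> \<theta> t) = ren (\<rho>' \<circ> \<rho>) (\<theta>' \<circ> \<theta>) t"
proof (induction t arbitrary: \<rho> \<theta> \<rho>' \<theta>')
  case (Lam t)
  have "case_nat 0 (Suc \<circ> \<rho>') \<circ> case_nat 0 (Suc \<circ> \<rho>) = case_nat 0 (Suc \<circ> (\<rho>' \<circ> \<rho>))"
    by (auto simp: fun_eq_iff comp_def id_def split: nat.split)
  with Lam show ?case by simp
next
  case (Mu t)
  have "case_nat 0 (Suc \<circ> \<theta>') \<circ> case_nat 0 (Suc \<circ> \<theta>) = case_nat 0 (Suc \<circ> (\<theta>' \<circ> \<theta>))"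
    by (auto simp: fun_eq_iff comp_def id_def split: nat.split)
  with Mu show ?case by simp
qed (simp_all add: comp_apply id_apply)

lemma sub_ren: "sub \<sigma> \<theta>' \<kappa> (ren \<rho> \<theta> t) = sub (\<sigma> \<circ> \<rho>) (\<theta>' \<circ> \<theta>) (\<kappa> \<circ> \<theta>) t"
proof (induction t arbitrary: \<sigma> \<theta>' \<kappa> \<rho> \<theta>)
  case (Lam t)
  have "case_nat (LVar 0) (ren Suc id \<circ> \<sigma>) \<circ> case_nat 0 (Suc \<circ> \<rho>)
      = case_nat (LVar 0) (ren Suc id \<circ> (\<sigma> \<circ> \<rho>))"
    by (auto simp: fun_eq_iff comp_def id_def split: nat.split)
  with Lam show ?case by (simp add: comp_assoc)
next
  case (Mu t)
  have "case_nat 0 (Suc \<circ> \<theta>') \<circ> case_nat 0 (Suc \<circ> \<theta>) = case_nat 0 (Suc \<circ> (\<theta>' \<circ> \<theta>))"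
    and "case_nat [] (map (ren id Suc) \<circ> \<kappa>) \<circ> case_nat 0 (Suc \<circ> \<theta>)
      = case_nat [] (map (ren id Suc) \<circ> (\<kappa> \<circ> \<theta>))"
    by (auto simp: fun_eq_iff comp_def id_def split: nat.split)
  with Mu show ?case by (simp add: comp_assoc)
qed (simp_all add: comp_apply id_apply)

lemma ren_sub:
  "ren \<rho> \<theta>' (sub \<sigma> \<theta> \<kappa> t) = sub (ren \<rho> \<theta>' \<circ> \<sigma>) (\<theta>' \<circ> \<theta>) (map (ren \<rho> \<theta>') \<circ> \<kappa>) t"
proof (induction t arbitrary: \<sigma> \<theta> \<kappa> \<rho> \<theta>')
  case (Lam t)
  have "ren (case_nat 0 (Suc \<circ> \<rho>)) \<theta>' \<circ> case_nat (LVar 0) (ren Suc id \<circ> \<sigma>)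
      = case_nat (LVar 0) (ren Suc id \<circ> (ren \<rho> \<theta>' \<circ> \<sigma>))"
    and "map (ren (case_nat 0 (Suc \<circ> \<rho>)) \<theta>') \<circ> (map (ren Suc id) \<circ> \<kappa>)
      = map (ren Suc id) \<circ> (map (ren \<rho> \<theta>') \<circ> \<kappa>)"
    by (auto simp: fun_eq_iff ren_ren comp_def id_def split: nat.split)
  with Lam show ?case by simp
next
  case (Mu t)
  have "ren \<rho> (case_nat 0 (Suc \<circ> \<theta>')) \<circ> (ren id Suc \<circ> \<sigma>) = ren id Suc \<circ> (ren \<rho> \<theta>' \<circ> \<sigma>)"
    and "case_nat 0 (Suc \<circ> \<theta>') \<circ> case_nat 0 (Suc \<circ> \<theta>) = case_nat 0 (Suc \<circ> (\<theta>' \<circ> \<theta>))"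
    and "map (ren \<rho> (case_nat 0 (Suc \<circ> \<theta>'))) \<circ> case_nat [] (map (ren id Suc) \<circ> \<kappa>)
      = case_nat [] (map (ren id Suc) \<circ> (map (ren \<rho> \<theta>') \<circ> \<kappa>))"
    by (auto simp: fun_eq_iff ren_ren comp_def id_def split: nat.split)
  with Mu show ?case by simp
qed (simp_all add: ren_apps comp_apply)

text \<open>The inner substitution has already attached \<open>\<kappa> a\<close> when the outer one
  meets the variable \<open>\<theta> a\<close>, so the outer stack comes behind the substituted
  inner one.\<close>

lemma sub_sub:
  "sub \<sigma>' \<theta>' \<kappa>' (sub \<sigma> \<theta> \<kappa> t)
    = sub (sub \<sigma>' \<theta>' \<kappa>' \<circ> \<sigma>) (\<theta>' \<circ> \<theta>) (\<lambda>a. map (sub \<sigma>' \<theta>' \<kappa>') (\<kappa> a) @ \<kappa>' (\<theta> a)) t"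
proof (induction t arbitrary: \<sigma> \<theta> \<kappa> \<sigma>' \<theta>' \<kappa>')
  case (Lam t)
  let ?s = "sub (case_nat (LVar 0) (ren Suc id \<circ> \<sigma>')) \<theta>' (map (ren Suc id) \<circ> \<kappa>')"
  have "?s \<circ> case_nat (LVar 0) (ren Suc id \<circ> \<sigma>)
      = case_nat (LVar 0) (ren Suc id \<circ> (sub \<sigma>' \<theta>' \<kappa>' \<circ> \<sigma>))"
    and "(\<lambda>a. map ?s ((map (ren Suc id) \<circ> \<kappa>) a) @ (map (ren Suc id) \<circ> \<kappa>') (\<theta> a))
      = map (ren Suc id) \<circ> (\<lambda>a. map (sub \<sigma>' \<theta>' \<kappa>') (\<kappa> a) @ \<kappa>' (\<theta> a))"
    by (auto simp: fun_eq_iff comp_def id_def sub_ren ren_sub split: nat.split)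
  with Lam show ?case by simp
next
  case (Mu t)
  let ?s = "sub (ren id Suc \<circ> \<sigma>') (case_nat 0 (Suc \<circ> \<theta>')) (case_nat [] (map (ren id Suc) \<circ> \<kappa>'))"
  have "?s \<circ> (ren id Suc \<circ> \<sigma>) = ren id Suc \<circ> (sub \<sigma>' \<theta>' \<kappa>' \<circ> \<sigma>)"
    and "case_nat 0 (Suc \<circ> \<theta>') \<circ> case_nat 0 (Suc \<circ> \<theta>) = case_nat 0 (Suc \<circ> (\<theta>' \<circ> \<theta>))"
    and "(\<lambda>a. map ?s (case_nat [] (map (ren id Suc) \<circ> \<kappa>) a)
          @ case_nat [] (map (ren id Suc) \<circ> \<kappa>') (case_nat 0 (Suc \<circ> \<theta>) a))
      = case_nat [] (map (ren id Suc) \<circ> (\<lambda>a. map (sub \<sigma>' \<theta>' \<kappa>') (\<kappa> a) @ \<kappa>' (\<theta> a)))"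
    by (auto simp: fun_eq_iff comp_def id_def sub_ren ren_sub split: nat.split)
  with Mu show ?case by simp
qed (simp_all add: sub_apps comp_apply apps_append)

lemma ren_eq_sub: "ren \<rho> \<theta> t = sub (LVar \<circ> \<rho>) \<theta> (\<lambda>_. []) t"
proof (induction t arbitrary: \<rho> \<theta>)
  case (Lam t)
  have "case_nat (LVar 0) (ren Suc id \<circ> (LVar \<circ> \<rho>)) = LVar \<circ> case_nat 0 (Suc \<circ> \<rho>)"
    by (auto simp: fun_eq_iff comp_def id_def split: nat.split)
  with Lam show ?case by (simp add: comp_def)
next
  case (Mu t)
  have "ren id Suc \<circ> (LVar \<circ> \<rho>) = LVar \<circ> \<rho>"
    and "case_nat [] (map (ren id Suc) \<circ> (\<lambda>_. [])) = (\<lambda>_. [])"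
    by (auto simp: fun_eq_iff comp_def id_def split: nat.split)
  with Mu show ?case by simp
qed (simp_all add: comp_apply id_apply)

lemma sub_id [simp]: "sub LVar id (\<lambda>_. []) t = t"
  using ren_eq_sub[of id id t] by simp

section \<open>The de Bruijn operations as instances\<close>

lemma llift_eq_ren: "llift t k = ren (\<lambda>i. if i < k then i else Suc i) id t"
proof (induction t arbitrary: k)
  case (Lam t)
  have "case_nat 0 (Suc \<circ> (\<lambda>i. if i < k then i else Suc i))
      = (\<lambda>i. if i < Suc k then i else Suc i)"
    by (auto simp: fun_eq_iff comp_def id_def split: nat.split)
  with Lam show ?case by simp
qed (simp_all add: comp_apply id_apply)

lemma mlift_eq_ren: "mlift t k = ren id (\<lambda>a. if a < k then a else Suc a) t"
proof (induction t arbitrary: k)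
  case (Mu t)
  have "case_nat 0 (Suc \<circ> (\<lambda>a. if a < k then a else Suc a))
      = (\<lambda>a. if a < Suc k then a else Suc a)"
    by (auto simp: fun_eq_iff comp_def id_def split: nat.split)
  with Mu show ?case by simp
qed (simp_all add: comp_apply id_apply)

lemma llift_0: "llift t 0 = ren Suc id t"
  by (simp add: llift_eq_ren)

lemma mlift_0: "mlift t 0 = ren id Suc t"
  by (simp add: mlift_eq_ren)

lemma lsubst_eq_sub:
  "lsubst t k v
    = sub (\<lambda>i. if i < k then LVar i else if i = k then v else LVar (i - 1)) id (\<lambda>_. []) t"
proof (induction t arbitrary: k v)
  case (Lam t)
  have "case_nat (LVar 0)
        (ren Suc id \<circ> (\<lambda>i. if i < k then LVar i else if i = k then v else LVar (i - 1)))
      = (\<lambda>i. if i < Suc k then LVar i else if i = Suc k then ren Suc id v else LVar (i - 1))"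
    by (auto simp: fun_eq_iff comp_def id_def split: nat.split)
  with Lam show ?case by (simp add: llift_0 comp_def)
next
  case (Mu t)
  have "ren id Suc \<circ> (\<lambda>i. if i < k then LVar i else if i = k then v else LVar (i - 1))
      = (\<lambda>i. if i < k then LVar i else if i = k then ren id Suc v else LVar (i - 1))"
    and "case_nat [] (map (ren id Suc) \<circ> (\<lambda>_. [])) = (\<lambda>_. [])"
    by (auto simp: fun_eq_iff comp_def id_def split: nat.split)
  with Mu show ?case by (simp add: mlift_0)
qed (simp_all add: comp_apply id_apply)

lemma msubst_eq_sub: "msubst t a v = sub LVar id (\<lambda>b. if b = a then [v] else []) t"
proof (induction t arbitrary: a v)
  case (Lam t)
  have "case_nat (LVar 0) (ren Suc id \<circ> LVar) = LVar"
    and "map (ren Suc id) \<circ> (\<lambda>b. if b = a then [v] else [])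
      = (\<lambda>b. if b = a then [ren Suc id v] else [])"
    by (auto simp: fun_eq_iff comp_def id_def split: nat.split)
  with Lam show ?case by (simp add: llift_0)
next
  case (Mu t)
  have "ren id Suc \<circ> LVar = LVar"
    and "case_nat [] (map (ren id Suc) \<circ> (\<lambda>b. if b = a then [v] else []))
      = (\<lambda>b. if b = Suc a then [ren id Suc v] else [])"
    by (auto simp: fun_eq_iff comp_def id_def split: nat.split)
  with Mu show ?case by (simp add: mlift_0)
qed (simp_all add: comp_apply id_apply)

declare id_apply [simp] comp_apply [simp]

subsection \<open>Head reduction on stacks\<close>

text \<open>Going under the binder shifted the values of \<open>\<sigma>\<close> and
  \<open>\<kappa>\<close>; \<open>lsubst\<close> at 0 undoes the shift. So a beta step just extends
  the environment by \<open>v\<close>.\<close>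

lemma lsubst_sub:
  "lsubst (sub (case_nat (LVar 0) (ren Suc id \<circ> \<sigma>)) \<theta> (map (ren Suc id) \<circ> \<kappa>) t) 0 v
    = sub (case_nat v \<sigma>) \<theta> \<kappa> t"
proof -
  let ?s = "sub (\<lambda>i. if i < 0 then LVar i else if i = 0 then v else LVar (i - 1)) id (\<lambda>_. [])"
  have "?s (ren Suc id u) = u" for u
    by (simp add: sub_ren comp_def flip: id_def)
  then have "?s \<circ> case_nat (LVar 0) (ren Suc id \<circ> \<sigma>) = case_nat v \<sigma>"
    and "(\<lambda>a. map ?s ((map (ren Suc id) \<circ> \<kappa>) a) @ []) = \<kappa>"
    by (auto simp: fun_eq_iff comp_def id_def map_idI split: nat.split)
  then show ?thesis by (simp add: lsubst_eq_sub sub_sub)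
qed

text \<open>Lifting skips index 0, so there is no named subterm to receive the argument.\<close>

lemma msubst_ren_Suc: "msubst (ren id Suc u) 0 v = ren id Suc u"
  by (simp add: msubst_eq_sub sub_ren comp_def) (simp add: ren_eq_sub comp_def)

text \<open>Only index 0 is sent to 0 by \<open>case_nat 0 (Suc \<circ> \<theta>)\<close>, so only
  its stack gains an argument. The entries of \<open>\<pi>\<close> may mention that index and are
  substituted as well.\<close>

lemma msubst_sub:
  "msubst (sub (ren id Suc \<circ> \<sigma>) (case_nat 0 (Suc \<circ> \<theta>))
      (case_nat \<pi> (map (ren id Suc) \<circ> \<kappa>)) t) 0 (ren id Suc v)
    = sub (ren id Suc \<circ> \<sigma>) (case_nat 0 (Suc \<circ> \<theta>))
      (case_nat (map (\<lambda>u. msubst u 0 (ren id Suc v)) \<pi> @ [ren id Suc v])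
        (map (ren id Suc) \<circ> \<kappa>)) t"
proof -
  let ?s = "sub LVar id (\<lambda>b. if b = 0 then [ren id Suc v] else [])"
  have s: "?s (ren id Suc u) = ren id Suc u" for u
    using msubst_ren_Suc by (simp add: msubst_eq_sub)
  have "?s \<circ> (ren id Suc \<circ> \<sigma>) = ren id Suc \<circ> \<sigma>"
    and "(\<lambda>a. map ?s (case_nat \<pi> (map (ren id Suc) \<circ> \<kappa>) a)
          @ (if case_nat 0 (Suc \<circ> \<theta>) a = 0 then [ren id Suc v] else []))
      = case_nat (map ?s \<pi> @ [ren id Suc v]) (map (ren id Suc) \<circ> \<kappa>)"
    by (auto simp: fun_eq_iff s split: nat.split)
  then show ?thesis by (simp add: msubst_eq_sub sub_sub)
qed

lemma red_apps: "red t t' \<Longrightarrow> red (apps t us) (apps t' us)"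
  by (induction us arbitrary: t t') (simp_all add: red_AppL)

lemma reds_Mu: "reds t t' \<Longrightarrow> reds (Mu t) (Mu t')"
  by (induction rule: rtranclp_induct) (auto intro: red_Mu rtranclp.rtrancl_into_rtrancl)

lemma reds_MApp: "reds t t' \<Longrightarrow> reds (MApp a t) (MApp a t')"
  by (induction rule: rtranclp_induct) (auto intro: red_MApp rtranclp.rtrancl_into_rtrancl)

lemma red_apps_Lam_sub:
  "red (apps (sub \<sigma> \<theta> \<kappa> (Lam t)) (v # \<pi>)) (apps (sub (case_nat v \<sigma>) \<theta> \<kappa> t) \<pi>)"
  using red_apps[OF red_beta,
      of "sub (case_nat (LVar 0) (ren Suc id \<circ> \<sigma>)) \<theta> (map (ren Suc id) \<circ> \<kappa>) t" v \<pi>]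
  by (simp add: lsubst_sub)

text \<open>Each \<mu>-step moves one argument from \<open>\<pi>\<close> to the end of
  \<open>\<pi>'\<close>, the arguments already absorbed; \<open>\<pi>'\<close> is general for the
  induction on \<open>\<pi>\<close>.\<close>

lemma reds_apps_Mu_sub_append:
  "reds (apps (Mu (sub (ren id Suc \<circ> \<sigma>) (case_nat 0 (Suc \<circ> \<theta>))
        (case_nat (map (ren id Suc) \<pi>') (map (ren id Suc) \<circ> \<kappa>)) t)) \<pi>)
    (Mu (sub (ren id Suc \<circ> \<sigma>) (case_nat 0 (Suc \<circ> \<theta>))
        (case_nat (map (ren id Suc) (\<pi>' @ \<pi>)) (map (ren id Suc) \<circ> \<kappa>)) t))"
proof (induction \<pi> arbitrary: \<pi>')
  case (Cons v \<pi>)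
  let ?r = "\<lambda>\<pi>'. sub (ren id Suc \<circ> \<sigma>) (case_nat 0 (Suc \<circ> \<theta>))
    (case_nat (map (ren id Suc) \<pi>') (map (ren id Suc) \<circ> \<kappa>)) t"
  \<comment> \<open>The entries of \<open>\<pi>'\<close> are lifted, so \<open>msubst\<close> leaves
    them as they are.\<close>
  have "msubst (?r \<pi>') 0 (mlift v 0) = ?r (\<pi>' @ [v])"
    by (simp add: mlift_0 msubst_sub msubst_ren_Suc cong: map_cong)
  then have "red (apps (Mu (?r \<pi>')) (v # \<pi>)) (apps (Mu (?r (\<pi>' @ [v]))) \<pi>)"
    using red_apps[OF red_mu[of "?r \<pi>'" v]] by simp
  also have "reds \<dots> (Mu (?r ((\<pi>' @ [v]) @ \<pi>)))"
    by (rule Cons.IH)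
  finally show ?case unfolding append_assoc append_Cons append_Nil .
qed simp

text \<open>Under \<open>Mu\<close>, \<open>sub\<close> starts the bound variable with the empty
  stack, the case \<open>\<pi>' = []\<close>. In the end that variable has captured all of
  \<open>\<pi>\<close>.\<close>

lemma reds_apps_Mu_sub:
  "reds (apps (sub \<sigma> \<theta> \<kappa> (Mu t)) \<pi>)
    (Mu (sub (ren id Suc \<circ> \<sigma>) (case_nat 0 (Suc \<circ> \<theta>)) (map (ren id Suc) \<circ> case_nat \<pi> \<kappa>) t))"
proof -
  have "case_nat (map (ren id Suc) \<pi>) (map (ren id Suc) \<circ> \<kappa>) = map (ren id Suc) \<circ> case_nat \<pi> \<kappa>"
    by (auto simp: fun_eq_iff comp_def id_def split: nat.split)
  then show ?thesis using reds_apps_Mu_sub_append[of \<sigma> \<theta> "[]" \<kappa> t \<pi>] by simp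
qed

subsection \<open>Realizability\<close>

text \<open>The pole of classical realizability; adequacy rests on its closure under backward
  reduction, \<open>Mu\<close> and \<open>MApp\<close>.\<close>

definition pole :: "nat \<Rightarrow> trm set" where
  "pole x = {t. \<exists>s \<in> mu_prefixed x. reds t s}"

lemma pole_expand: "reds t t' \<Longrightarrow> t' \<in> pole x \<Longrightarrow> t \<in> pole x"
  unfolding pole_def by (blast intro: rtranclp_trans)

lemma LVar_in_pole: "LVar x \<in> pole x"
  unfolding pole_def by (blast intro: mu_prefixed_var)

lemma Mu_in_pole: "t \<in> pole x \<Longrightarrow> Mu t \<in> pole x"
  unfolding pole_def by (blast intro: mu_prefixed_Mu reds_Mu)

lemma MApp_in_pole: "t \<in> pole x \<Longrightarrow> MApp a t \<in> pole x"
  unfolding pole_def by (blast intro: mu_prefixed_MApp reds_MApp)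

text \<open>
  Realizers are required to be stable under renaming of \<open>\<mu>\<close>-variables because the
  \<open>\<mu>\<close>-reduction moves stacks under a \<open>\<mu>\<close>-binder.
\<close>

definition orth :: "nat \<Rightarrow> trm list set \<Rightarrow> trm set" where
  "orth x P = {t. \<forall>\<theta>. \<forall>\<pi> \<in> P. apps (ren id \<theta> t) \<pi> \<in> pole x}"

primrec stacks :: "nat \<Rightarrow> nat list \<Rightarrow> ty \<Rightarrow> trm list set" where
  "stacks x ys (TVar X) = {map LVar ys}"
| "stacks x ys Bot = {[]}"
| "stacks x ys (Arrow A B) = {v # \<pi> | v \<pi>. v \<in> orth x (stacks x ys A) \<and> \<pi> \<in> stacks x ys B}"

lemma orthI: "(\<And>\<theta> \<pi>. \<pi> \<in> P \<Longrightarrow> apps (ren id \<theta> t) \<pi> \<in> pole x) \<Longrightarrow> t \<in> orth x P"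
  by (simp add: orth_def)

lemma orth_ren: "t \<in> orth x P \<Longrightarrow> ren id \<theta> t \<in> orth x P"
  by (simp add: orth_def ren_ren)

lemma orth_apps: "t \<in> orth x P \<Longrightarrow> \<pi> \<in> P \<Longrightarrow> apps t \<pi> \<in> pole x"
  unfolding orth_def using ren_id by (metis (mono_tags, lifting) mem_Collect_eq)

text \<open>\<open>ren id \<theta>\<close> fixes the variables in the stack of a
  \<open>TVar\<close>, and the arguments in arrow stacks are stable by
  \<open>orth_ren\<close>.\<close>

lemma stacks_ren: "\<pi> \<in> stacks x ys A \<Longrightarrow> map (ren id \<theta>) \<pi> \<in> stacks x ys A"
  by (induction A arbitrary: \<pi>) (auto simp: orth_ren)

text \<open>Adequacy, by induction on the typing. \<open>\<theta>\<close> is unconstrained because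
  the pole is closed under \<open>MApp a\<close> for every \<open>a\<close>.\<close>

lemma sub_in_orth:
  assumes "typing \<Gamma> t A \<Delta>"
    and "\<And>i. i < length \<Gamma> \<Longrightarrow> \<sigma> i \<in> orth x (stacks x ys (\<Gamma> ! i))"
    and "\<And>a. a < length \<Delta> \<Longrightarrow> \<kappa> a \<in> stacks x ys (\<Delta> ! a)"
  shows "sub \<sigma> \<theta> \<kappa> t \<in> orth x (stacks x ys A)"
proof -
  \<comment> \<open>The renaming in \<open>orth\<close> is left out of the induction: by
    \<open>ren_sub\<close> a renamed instance of \<open>t\<close> is again an instance.\<close>
  have "apps (sub \<sigma> \<theta> \<kappa> t) \<pi> \<in> pole x"
    if "typing \<Gamma> t A \<Delta>"
      and "\<And>i. i < length \<Gamma> \<Longrightarrow> \<sigma> i \<in> orth x (stacks x ys (\<Gamma> ! i))"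
      and "\<And>a. a < length \<Delta> \<Longrightarrow> \<kappa> a \<in> stacks x ys (\<Delta> ! a)"
      and "\<pi> \<in> stacks x ys A"
    for \<Gamma> t A \<Delta> \<sigma> \<theta> \<kappa> \<pi>
    using that
  proof (induction arbitrary: \<sigma> \<theta> \<kappa> \<pi> rule: typing.induct)
    case (typing_ax i \<Gamma> A \<Delta>)
    then show ?case by (auto intro: orth_apps)
  next
    case (typing_arrI A \<Gamma> t B \<Delta>)
    then obtain v \<pi>' where \<pi>: "\<pi> = v # \<pi>'"
      and v: "v \<in> orth x (stacks x ys A)" and \<pi>': "\<pi>' \<in> stacks x ys B"
      by auto
    have "apps (sub (case_nat v \<sigma>) \<theta> \<kappa> t) \<pi>' \<in> pole x"
    proof (rule typing_arrI.IH)
      show "case_nat v \<sigma> i \<in> orth x (stacks x ys ((A # \<Gamma>) ! i))" if "i < length (A # \<Gamma>)" for i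
        using that v typing_arrI.prems(1) by (cases i) auto
    qed (use typing_arrI.prems(2) \<pi>' in auto)
    then show ?case
      unfolding \<pi> by (rule pole_expand[OF r_into_rtranclp[of red, OF red_apps_Lam_sub]])
  next
    case (typing_arrE \<Gamma> u A B \<Delta> v)
    \<comment> \<open>All renamings of the argument must be covered; \<open>ren_sub\<close> moves
      them into \<open>\<sigma>\<close>, \<open>\<theta>\<close> and \<open>\<kappa>\<close>, over
      which the induction hypothesis is general.\<close>
    have "sub \<sigma> \<theta> \<kappa> v \<in> orth x (stacks x ys A)"
      by (intro orthI)
        (auto simp: ren_sub intro!: typing_arrE.IH(2) orth_ren stacks_ren typing_arrE.prems)
    then have "apps (sub \<sigma> \<theta> \<kappa> u) (sub \<sigma> \<theta> \<kappa> v # \<pi>) \<in> pole x"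
      using typing_arrE.prems by (intro typing_arrE.IH(1)) auto
    then show ?case by simp
  next
    case (typing_mu \<Gamma> t A \<Delta>)
    \<comment> \<open>\<open>\<pi>\<close> becomes the stack of the bound \<mu>-variable, and the
      body, of type \<open>Bot\<close>, is run on the empty stack.\<close>
    let ?t = "sub (ren id Suc \<circ> \<sigma>) (case_nat 0 (Suc \<circ> \<theta>)) (map (ren id Suc) \<circ> case_nat \<pi> \<kappa>) t"
    have "apps ?t [] \<in> pole x"
    proof (rule typing_mu.IH)
      show "(map (ren id Suc) \<circ> case_nat \<pi> \<kappa>) a \<in> stacks x ys ((A # \<Delta>) ! a)"
        if "a < length (A # \<Delta>)" for a
        using that typing_mu.prems by (cases a) (auto intro: stacks_ren)
    qed (use typing_mu.prems in \<open>auto intro: orth_ren\<close>)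
    then have "Mu ?t \<in> pole x" by (simp add: Mu_in_pole)
    then show ?case by (rule pole_expand[OF reds_apps_Mu_sub])
  next
    case (typing_bot \<Gamma> t A a \<Delta>)
    \<comment> \<open>\<open>\<kappa> a\<close> is a stack of the type of \<open>t\<close>, so the
      induction hypothesis applies to it; \<open>\<pi>\<close> itself is empty.\<close>
    then show ?case by (auto intro!: MApp_in_pole)
  qed
  from this[OF assms(1)] show ?thesis
    by (intro orthI, unfold ren_sub) (simp add: orth_ren stacks_ren assms(2,3))
qed

theorem theorem2p20:
  fixes X :: nat and E :: trm and x :: nat and ys :: "nat list"
  assumes "closed_trm E"
    and "typing [] E (Arrow Bot (TVar X)) []"
    and "distinct (x # ys)"
  shows "\<exists>s \<in> mu_prefixed x. reds (apps (App E (LVar x)) (map LVar ys)) s"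
proof -
  have "E \<in> orth x (stacks x ys (Arrow Bot (TVar X)))"
    \<comment> \<open>Both contexts are empty, so the identity substitution is admissible and
      returns \<open>E\<close>.\<close>
    using sub_in_orth[OF assms(2), of LVar x ys "\<lambda>_. []" id] by simp
  moreover have "LVar x # map LVar ys \<in> stacks x ys (Arrow Bot (TVar X))"
    by (simp add: orth_def LVar_in_pole)
  ultimately have "apps E (LVar x # map LVar ys) \<in> pole x"
    by (rule orth_apps)
  then show ?thesis by (simp add: pole_def)
qed

end
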